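(* Let $\ell\ge 2$ be an integer and let $\lambda$ be a partition. Then $\lambda$ is an $\ell$-partition if and only if it satisfies $$(\star)\qquad \nu_\ell\big(h^\lambda_{(a,c)}\big)=\nu_\ell\big(h^\lambda_{(b,c)}\big)\quad\text{for all pairs of boxes }(a,c),(b,c)\text{ in the Young diagram of }\lambda .$$
   Context: $(x,y)$ denotes the box in row $x$ and column $y$ of the Young diagram of a partition (row $j$ has $\lambda_j$ boxes, left-justified, rows numbered from the top). The hook length $h^\lambda_{(a,b)}$ is the number of boxes to the right of and below $(a,b)$ (same row or same column), including $(a,b)$ itself. For $k\in\mathbb Z$, $\nu_\ell(k)=1$ if $\ell\mid k$ and $\nu_\ell(k)=0$ otherwise. A partition is $\ell$-regular if it does not have $\ell$ or more equal nonzero parts. A removable $\ell$-rim hook (for short, $\ell$-rim hook) of $\lambda$ is a connected sequence of $\ell$ boxes of the Young diagram of $\lambda$, containing no $2\times2$ square, whose removal from $\lambda$ leaves the Young diagram of a partition. It is horizontal if all its boxes lie in one row, and non-horizontal otherwise. An $\ell$-partition is an $\ell$-regular partition which has no non-horizontal $\ell$-rim hooks and such that, after removing any number of horizontal $\ell$-rim hooks in any order, the remaining diagram has no non-horizontal $\ell$-rim hooks. *)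

theory Defs
  imports Main
begin

definition is_partition :: "nat list \<Rightarrow> bool" where
  "is_partition lam \<longleftrightarrow> sorted_wrt (\<ge>) lam \<and> (\<forall>k\<in>set lam. k > 0)"

text \<open>Boxes are pairs (row, column), both numbered from 1, while list indices start at 0.\<close>

definition young_diagram :: "nat list \<Rightarrow> (nat \<times> nat) set" where
  "young_diagram lam =
     {(x, y). 1 \<le> x \<and> x \<le> length lam \<and> 1 \<le> y \<and> y \<le> lam ! (x - 1)}"

definition hook :: "nat list \<Rightarrow> nat \<times> nat \<Rightarrow> (nat \<times> nat) set" where
  "hook lam = (\<lambda>(a, b).
     {(x, y) \<in> young_diagram lam. (x = a \<and> y \<ge> b) \<or> (y = b \<and> x \<ge> a)})"

definition hook_length :: "nat list \<Rightarrow> nat \<times> nat \<Rightarrow> nat" where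
  "hook_length lam p = card (hook lam p)"

definition nu :: "nat \<Rightarrow> int \<Rightarrow> nat" where
  "nu l k = (if int l dvd k then 1 else 0)"

definition regular :: "nat \<Rightarrow> nat list \<Rightarrow> bool" where
  "regular l lam \<longleftrightarrow> \<not> (\<exists>k>0. count_list lam k \<ge> l)"

text \<open>Two boxes are adjacent when they share an edge; a set of boxes is connected when any two
  of its boxes are joined by a path of adjacent boxes inside the set.\<close>

definition adjacent :: "((nat \<times> nat) \<times> (nat \<times> nat)) set" where
  "adjacent = {((x, y), (x', y')).
     (x = x' \<and> (y' = Suc y \<or> y = Suc y')) \<or> (y = y' \<and> (x' = Suc x \<or> x = Suc x'))}"

definition connected_boxes :: "(nat \<times> nat) set \<Rightarrow> bool" where
  "connected_boxes S \<longleftrightarrow> (\<forall>p\<in>S. \<forall>q\<in>S. (p, q) \<in> (adjacent \<inter> S \<times> S)\<^sup>*)"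

definition contains_square :: "(nat \<times> nat) set \<Rightarrow> bool" where
  "contains_square S \<longleftrightarrow>
     (\<exists>x y. {(x, y), (x, Suc y), (Suc x, y), (Suc x, Suc y)} \<subseteq> S)"

definition rim_hook :: "nat \<Rightarrow> nat list \<Rightarrow> (nat \<times> nat) set \<Rightarrow> bool" where
  "rim_hook l lam S \<longleftrightarrow>
     S \<subseteq> young_diagram lam \<and> card S = l \<and> connected_boxes S \<and> \<not> contains_square S \<and>
     (\<exists>mu. is_partition mu \<and> young_diagram mu = young_diagram lam - S)"

definition horizontal :: "(nat \<times> nat) set \<Rightarrow> bool" where
  "horizontal S \<longleftrightarrow> (\<exists>x. \<forall>p\<in>S. fst p = x)"

definition remove_horizontal :: "nat \<Rightarrow> nat list \<Rightarrow> nat list \<Rightarrow> bool" where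
  "remove_horizontal l lam mu \<longleftrightarrow>
     (\<exists>S. rim_hook l lam S \<and> horizontal S \<and>
          is_partition mu \<and> young_diagram mu = young_diagram lam - S)"

definition no_non_horizontal :: "nat \<Rightarrow> nat list \<Rightarrow> bool" where
  "no_non_horizontal l lam \<longleftrightarrow> \<not> (\<exists>S. rim_hook l lam S \<and> \<not> horizontal S)"

definition l_partition :: "nat \<Rightarrow> nat list \<Rightarrow> bool" where
  "l_partition l lam \<longleftrightarrow>
     is_partition lam \<and> regular l lam \<and> no_non_horizontal l lam \<and>
     (\<forall>mu. (remove_horizontal l)\<^sup>*\<^sup>* lam mu \<longrightarrow> no_non_horizontal l mu)"

end

theory Submission
  imports Defs
begin

text \<open>Encode \<open>\<lambda>\<close> by the beads \<open>\<lambda>\<^sub>i - i\<close> on the integers (Maya diagram). Columns correspond to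
  the positions without a bead (gaps), and the hook length of a box is its row's bead minus its
  column's gap. Removing an \<open>l\<close>-rim hook moves a bead \<open>b\<close> to a gap \<open>b - l\<close>, and the hook is
  horizontal iff no bead is jumped over. Condition \<open>(\<star>)\<close> says that, for each gap \<open>x\<close>, the
  beads above \<open>x\<close> are either all congruent to \<open>x\<close> modulo \<open>l\<close> or all incongruent to it. This
  excludes jumps and is preserved by moves; it excludes \<open>l\<close> adjacent beads above a gap, hence forces
  regularity. Conversely, induct on the size: if all moves of a bead jump over nothing and lead to a
  configuration with \<open>(\<star>)\<close>, then the original one has \<open>(\<star>)\<close>.\<close>

section \<open>Beads and gaps on the integers\<close>

text \<open>Padding with zeros gives every natural number a row, so the empty rows supply beads at
  all sufficiently low positions.\<close>

definition part :: "nat list \<Rightarrow> nat \<Rightarrow> nat" where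
  "part lam i = (if i < length lam then lam ! i else 0)"

definition beta :: "(nat \<Rightarrow> nat) \<Rightarrow> nat \<Rightarrow> int" where
  "beta f i = int (f i) - int i"

definition maya :: "nat list \<Rightarrow> int set" where
  "maya lam = range (beta (part lam))"

definition congruent_above :: "nat \<Rightarrow> int set \<Rightarrow> bool" where
  "congruent_above l B \<longleftrightarrow>
     (\<forall>x. x \<notin> B \<longrightarrow> (\<forall>b\<in>B. \<forall>d\<in>B. x < b \<longrightarrow> x < d \<longrightarrow> (int l dvd b - x \<longleftrightarrow> int l dvd d - x)))"

definition move :: "nat \<Rightarrow> int \<Rightarrow> int set \<Rightarrow> int set" where
  "move l b B = insert (b - int l) (B - {b})"

section \<open>Moves of beads and the congruence condition\<close>

lemma dvd_diff_shift:
  "int l dvd (b - int l) - y \<longleftrightarrow> int l dvd b - y"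
  "int l dvd y - (b - int l) \<longleftrightarrow> int l dvd y - b"
proof -
  have "(b - int l) - y = (b - y) + int l * (- 1)" "y - (b - int l) = (y - b) + int l * 1"
    by simp_all
  then show "int l dvd (b - int l) - y \<longleftrightarrow> int l dvd b - y"
    "int l dvd y - (b - int l) \<longleftrightarrow> int l dvd y - b"
    by (metis dvd_add_times_triv_right_iff mult.commute)+
qed

text \<open>The bead \<open>b\<close> lies exactly \<open>l\<close> above the gap
  \<open>b - l\<close>, so every bead above that gap lies a multiple of \<open>l\<close> above it. A
  jumped bead would have a distance strictly between 0 and \<open>l\<close>.\<close>

lemma congruent_above_no_between:
  assumes "congruent_above l B" "b \<in> B" "b - int l \<notin> B"
  shows "B \<inter> {b - int l<..<b} = {}"
proof (rule ccontr)
  assume "B \<inter> {b - int l<..<b} \<noteq> {}"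
  then obtain d where d: "d \<in> B" "b - int l < d" "d < b" by auto
  have "int l dvd b - (b - int l)" by simp
  then have "int l dvd d - (b - int l)"
    using assms d unfolding congruent_above_def by (meson less_trans)
  then have "int l \<le> d - (b - int l)" using d by (intro zdvd_imp_le) auto
  then show False using d by simp
qed

text \<open>At an old gap, the moved bead can be replaced by \<open>b\<close>, which is higher and
  has the same residue. The only new gap is \<open>b\<close>: beads above it were above the gap
  \<open>b - l\<close> together with \<open>b\<close>, hence are congruent to
  \<open>b\<close>.\<close>

lemma congruent_above_move:
  assumes c: "congruent_above l B" and b: "b \<in> B" "b - int l \<notin> B"
  shows "congruent_above l (move l b B)"
  unfolding congruent_above_def
proof (intro allI impI ballI)
  fix x p q
  assume x: "x \<notin> move l b B" and p: "p \<in> move l b B" "x < p" and q: "q \<in> move l b B" "x < q"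
  have l0: "l > 0" using b by (cases l) auto
  have lift: "\<exists>r'. r' \<in> B \<and> r \<le> r' \<and> (int l dvd r' - y \<longleftrightarrow> int l dvd r - y)"
    if "r \<in> move l b B" for r y
  proof (cases "r = b - int l")
    case True
    then show ?thesis using b by (intro exI[of _ b]) (simp add: dvd_diff_shift)
  next
    case False
    then show ?thesis using that by (auto simp: move_def)
  qed
  show "int l dvd p - x \<longleftrightarrow> int l dvd q - x"
  proof (cases "x = b")
    case True
    have above: "int l dvd r - b" if "r \<in> move l b B" "b < r" for r
    proof -
      have "r \<in> B" using that l0 by (auto simp: move_def)
      moreover have "int l dvd b - (b - int l)" by simp
      ultimately have "int l dvd r - (b - int l)"
        using c b l0 that(2) unfolding congruent_above_def
        by (smt (verit) of_nat_0_less_iff)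
      then have "int l dvd (r - b) + int l" by (simp add: algebra_simps)
      then show ?thesis by simp
    qed
    show ?thesis using above p q True by blast
  next
    case False
    then have "x \<notin> B" using x by (auto simp: move_def)
    moreover obtain p' where "p' \<in> B" "p \<le> p'" "int l dvd p' - x \<longleftrightarrow> int l dvd p - x"
      using lift[OF p(1)] by blast
    moreover obtain q' where "q' \<in> B" "q \<le> q'" "int l dvd q' - x \<longleftrightarrow> int l dvd q - x"
      using lift[OF q(1)] by blast
    ultimately show ?thesis using c p(2) q(2) unfolding congruent_above_def
      by (meson less_le_trans)
  qed
qed

text \<open>Otherwise descending from \<open>c\<close> in steps of \<open>l\<close> would never
  leave \<open>B\<close>, yet this descent hits \<open>x\<close>.\<close>

lemma movable_bead_exists:
  fixes x c :: int
  assumes "x \<notin> B" "c \<in> B" "x < c" "int l dvd c - x"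
  shows "\<exists>b\<in>B. b - int l \<notin> B"
proof (rule ccontr)
  assume H: "\<not> ?thesis"
  obtain k where k: "c - x = int l * k" using assms by blast
  have "k \<ge> 0"
  proof (rule ccontr)
    assume "\<not> k \<ge> 0"
    then have "int l * k \<le> 0" by (intro mult_nonneg_nonpos) auto
    then show False using k assms(3) by simp
  qed
  have "c - int l * int n \<in> B" for n
  proof (induction n)
    case (Suc n)
    then have "(c - int l * int n) - int l \<in> B" using H by blast
    then show ?case by (simp add: algebra_simps)
  qed (use assms in simp)
  from this[of "nat k"] show False using assms(1) k \<open>k \<ge> 0\<close> by (simp add: algebra_simps)
qed

lemma least_above:
  fixes b c :: int
  assumes "c \<in> B" "b < c"
  obtains d where "d \<in> B" "b < d" "\<And>e. e \<in> B \<Longrightarrow> b < e \<Longrightarrow> d \<le> e"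
proof -
  \<comment> \<open>Integers above \<open>b\<close> are indexed by naturals, which are
    well-ordered.\<close>
  let ?P = "\<lambda>n. b + 1 + int n \<in> B"
  have "?P (nat (c - b - 1))" using assms by simp
  then have L: "?P (LEAST n. ?P n)" by (rule LeastI)
  show thesis
  proof (rule that[OF L])
    fix e assume e: "e \<in> B" "b < e"
    then have "?P (nat (e - b - 1))" by simp
    then have "(LEAST n. ?P n) \<le> nat (e - b - 1)" by (rule Least_le)
    then show "b + 1 + int (LEAST n. ?P n) \<le> e" using e by linarith
  qed simp
qed

text \<open>A violation at a gap \<open>x\<close> survives the move of \<open>b\<close>, unless \<open>x\<close> is \<open>b - l\<close> or \<open>b\<close> passes
  \<open>x\<close>. In these two cases the next bead \<open>e\<close> above \<open>b\<close> is moved instead: it cannot jump over \<open>b\<close>,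
  so it stays above \<open>b\<close> and the violation at \<open>x\<close> persists.\<close>

lemma congruent_above_from_moves:
  assumes l: "l > 0"
    and hor: "\<And>b. b \<in> B \<Longrightarrow> b - int l \<notin> B \<Longrightarrow> B \<inter> {b - int l<..<b} = {}"
    and IH: "\<And>b. b \<in> B \<Longrightarrow> b - int l \<notin> B \<Longrightarrow> congruent_above l (move l b B)"
  shows "congruent_above l B"
proof (rule ccontr)
  assume "\<not> congruent_above l B"
  then obtain x c d where x: "x \<notin> B" and c: "c \<in> B" "x < c" "int l dvd c - x"
    and d: "d \<in> B" "x < d" "\<not> int l dvd d - x"
    unfolding congruent_above_def by blast
  have mono: "int l dvd q - y" if "b \<in> B" "b - int l \<notin> B" "y \<notin> move l b B"
    "p \<in> move l b B" "q \<in> move l b B" "y < p" "y < q" "int l dvd p - y" for b y p q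
    using IH[OF that(1,2)] that unfolding congruent_above_def by blast
  obtain b where b: "b \<in> B" "b - int l \<notin> B"
    using movable_bead_exists[OF x c] by blast
  note free = hor[OF b]
  have xb: "x \<noteq> b" using x b by auto
  consider "x = b - int l" | "x \<noteq> b - int l" "b - int l < x" "x < b" "d = b"
    | "x \<noteq> b - int l" "\<not> (b - int l < x \<and> x < b \<and> d = b)" by blast
  then show False
  proof cases
    case 1
    have "d \<noteq> b" using d 1 by auto
    then have "b < d" using free d 1 by force
    then obtain e where e: "e \<in> B" "b < e" "\<And>e'. e' \<in> B \<Longrightarrow> b < e' \<Longrightarrow> e \<le> e'"
      using least_above d(1) by metis
    \<comment> \<open>Moving \<open>b\<close> turns it into a gap congruent to \<open>x\<close>; by
      \<open>IH\<close> at this gap, all beads above it behave like \<open>d\<close>.\<close>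
    have ne: "\<not> int l dvd e' - x" if "e' \<in> B" "b < e'" for e'
    proof
      assume "int l dvd e' - x"
      then have "int l dvd e' - b" using 1 by (simp add: dvd_diff_shift)
      then have "int l dvd d - b"
        using mono[OF b, of b e' d] that d \<open>b < d\<close> l by (auto simp: move_def)
      then show False using d 1 by (simp add: dvd_diff_shift)
    qed
    have nel: "\<not> int l dvd (e - int l) - x" using ne[OF e(1,2)] by (simp add: dvd_diff_shift)
    have "e - int l \<noteq> b" using nel 1 by auto
    \<comment> \<open>The position \<open>e - l\<close> is above \<open>b - l\<close> and differs
      from \<open>b\<close>. Beads above \<open>b\<close> start at \<open>e\<close>, and
      \<open>free\<close> excludes the rest.\<close>
    have g: "e - int l \<notin> B"
    proof
      assume "e - int l \<in> B"
      moreover have "\<not> b < e - int l" using calculation e(3) l by force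
      ultimately show False using free e(2) \<open>e - int l \<noteq> b\<close> by force
    qed
    have "b < e - int l" using hor[OF e(1) g] e(2) b(1) \<open>e - int l \<noteq> b\<close> by force
    \<comment> \<open>After the move of \<open>e\<close>, both \<open>b\<close> and
      \<open>e - l\<close> are beads above the gap \<open>x\<close>, and \<open>b\<close> is
      congruent to \<open>x\<close>.\<close>
    then have "int l dvd (e - int l) - x"
      using mono[OF e(1) g, of x b "e - int l"] 1 x b(1) e(2) l by (auto simp: move_def)
    then show False using nel by simp
  next
    case 2
    have "b < c" using free c 2 by (metis IntI empty_iff greaterThanLessThan_iff less_trans d(3) not_less_iff_gr_or_eq)
    then obtain e where e: "e \<in> B" "b < e" "\<And>e'. e' \<in> B \<Longrightarrow> b < e' \<Longrightarrow> e \<le> e'"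
      using least_above c(1) by metis
    \<comment> \<open>The move of \<open>b\<close> leaves \<open>x\<close> a gap and
      \<open>c\<close> in place, so \<open>e\<close> inherits the congruence of
      \<open>c\<close>.\<close>
    have ex: "int l dvd e - x"
      using mono[OF b, of x c e] x 2 c e \<open>b < c\<close> by (auto simp: move_def)
    then have exl: "int l dvd (e - int l) - x" by (simp add: dvd_diff_shift)
    have "e - int l \<noteq> b" using exl d 2 by auto
    have "e - int l \<ge> x" using ex 2 e(2) zdvd_imp_le[of "int l" "e - x"] by simp
    have g: "e - int l \<notin> B"
    proof
      assume "e - int l \<in> B"
      moreover have "\<not> b < e - int l" using calculation e(3) l by force
      ultimately show False using free 2 \<open>e - int l \<ge> x\<close> \<open>e - int l \<noteq> b\<close> by force
    qed
    have "b < e - int l" using hor[OF e(1) g] e(2) b(1) \<open>e - int l \<noteq> b\<close> by force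
    then have "int l dvd b - x"
      using mono[OF e(1) g, of x "e - int l" b] x b(1) e(2) 2 exl by (auto simp: move_def)
    then show False using d 2 by simp
  next
    case 3
    \<comment> \<open>The violating pair is followed through the move: residues are unchanged, and
      both beads stay above \<open>x\<close>. If \<open>c = b\<close>, this is because
      \<open>b\<close> lies at least \<open>l\<close> above \<open>x\<close>; if
      \<open>d = b\<close>, it is the case assumption.\<close>
    define c' where "c' = (if c = b then b - int l else c)"
    define d' where "d' = (if d = b then b - int l else d)"
    have m: "c' \<in> move l b B" "d' \<in> move l b B" "x \<notin> move l b B"
      using c d x 3 by (auto simp: move_def c'_def d'_def)
    have c'd: "int l dvd c' - x" using c by (auto simp: c'_def dvd_diff_shift)
    have "\<not> int l dvd d' - x" using d by (auto simp: d'_def dvd_diff_shift)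
    moreover have "x < c'"
    proof (cases "c = b")
      case True
      then have "int l \<le> b - x" using c by (intro zdvd_imp_le) auto
      then show ?thesis using 3 True by (simp add: c'_def)
    qed (use c in \<open>simp add: c'_def\<close>)
    moreover have "x < d'" using 3 d xb by (auto simp: d'_def)
    ultimately show False using mono[OF b m(3,1,2)] c'd by simp
  qed
qed

section \<open>Partitions as antitone functions\<close>

lemma part_antimono: "is_partition lam \<Longrightarrow> antimono (part lam)"
  unfolding is_partition_def part_def monotone_def
  by (auto simp: sorted_wrt_iff_nth_less le_less)

lemma part_length: "part lam (length lam) = 0"
  by (simp add: part_def)

lemma mem_young_diagram: "(x, y) \<in> young_diagram lam \<longleftrightarrow> 1 \<le> x \<and> 1 \<le> y \<and> y \<le> part lam (x - 1)"
  by (cases x) (auto simp: young_diagram_def part_def)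

lemma exists_partition:
  assumes "antimono f" "f n = 0"
  shows "\<exists>mu. is_partition mu \<and> part mu = f"
proof -
  \<comment> \<open>Parts must be positive, so the list is cut at the first zero; antitonicity makes
    all later values vanish.\<close>
  define m where "m = (LEAST i. f i = 0)"
  have m0: "f m = 0" unfolding m_def using assms(2) by (rule LeastI)
  have pos: "f i > 0" if "i < m" for i
    using not_less_Least[of i "\<lambda>i. f i = 0"] that by (simp add: m_def)
  have zero: "f i = 0" if "\<not> i < m" for i
    using antimonoD[OF assms(1), of m i] m0 that by simp
  have "is_partition (map f [0..<m])"
    using pos by (auto simp: is_partition_def sorted_wrt_iff_nth_less intro: antimonoD[OF assms(1)])
  moreover have "part (map f [0..<m]) = f"
    by (rule ext) (simp add: part_def zero)
  ultimately show ?thesis by blast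
qed

lemma finite_young_diagram: "finite (young_diagram lam)"
proof (rule finite_subset)
  show "young_diagram lam \<subseteq> Sigma {1..length lam} (\<lambda>x. {1..lam ! (x - 1)})"
    by (auto simp: young_diagram_def)
qed simp

lemma beta_less: "antimono f \<Longrightarrow> i < j \<Longrightarrow> beta f j < beta f i"
  using antimonoD[of f i j] by (simp add: beta_def)

lemma beta_less_iff: "antimono f \<Longrightarrow> beta f j < beta f i \<longleftrightarrow> i < j"
  using beta_less[of f i j] beta_less[of f j i] by (cases i j rule: linorder_cases) auto

text \<open>The successor form suits \<open>ribbon_exists\<close>, which seeks the last row whose
  bead exceeds \<open>t\<close>.\<close>

lemma beta_unbounded:
  assumes "antimono f"
  shows "\<exists>j. beta f (Suc j) < t"
proof -
  define n where "n = f 0 + nat (- t)"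
  have "f (Suc n) \<le> f 0" using antimonoD[OF assms, of 0 "Suc n"] by simp
  then have "beta f (Suc n) < t" unfolding beta_def n_def by linarith
  then show ?thesis ..
qed

section \<open>Ribbons and the bead moves they induce\<close>

text \<open>Row lengths \<open>f\<close> before and \<open>g\<close> after stripping a border strip
  from rows \<open>i\<close> to \<open>k\<close>, counted from 0. The middle condition says that
  consecutive rows of the strip share exactly one column; in beads it reads
  \<open>beta g j = beta f (Suc j)\<close>.\<close>

definition ribbon :: "(nat \<Rightarrow> nat) \<Rightarrow> (nat \<Rightarrow> nat) \<Rightarrow> nat \<Rightarrow> nat \<Rightarrow> bool" where
  "ribbon f g i k \<longleftrightarrow> i \<le> k \<and> (\<forall>j. j < i \<or> k < j \<longrightarrow> g j = f j) \<and>
     (\<forall>j. i \<le> j \<and> j < k \<longrightarrow> Suc (g j) = f (Suc j)) \<and> g k < f k"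

lemma ribbon_less:
  assumes "antimono f" "ribbon f g i k" "i \<le> j" "j \<le> k"
  shows "g j < f j"
proof (cases "j = k")
  case False
  then have "Suc (g j) = f (Suc j)" using assms by (simp add: ribbon_def)
  then show ?thesis using antimonoD[OF assms(1), of j "Suc j"] by simp
qed (use assms in \<open>simp add: ribbon_def\<close>)

text \<open>The beads of rows \<open>i + 1\<close> to \<open>k\<close> only change their index, so
  as a set the bead of row \<open>i\<close> is replaced by \<open>beta g k\<close>. This lies
  strictly between the old beads of rows \<open>k + 1\<close> and \<open>k\<close>, so exactly the
  beads of rows \<open>i + 1\<close> to \<open>k\<close> are jumped over.\<close>

lemma ribbon_beta:
  assumes f: "antimono f" and g: "antimono g" and r: "ribbon f g i k"
  shows "beta g k \<notin> range (beta f)"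
    and "range (beta g) = insert (beta g k) (range (beta f) - {beta f i})"
    and "range (beta f) \<inter> {beta g k<..<beta f i} = {} \<longleftrightarrow> i = k"
proof -
  have lt: "beta g k < beta f k" using r by (simp add: ribbon_def beta_def)
  have gt: "beta f (Suc k) < beta g k"
    using r antimonoD[OF g, of k "Suc k"] by (simp add: ribbon_def beta_def)
  have pos: "j \<le> k \<longleftrightarrow> beta g k < beta f j" for j
  proof
    assume "j \<le> k"
    then show "beta g k < beta f j" using lt beta_less[OF f, of j k] by (cases "j = k") auto
  next
    assume "beta g k < beta f j"
    then show "j \<le> k" using gt beta_less_iff[OF f, of "Suc k" j] by simp
  qed
  have shift: "beta g j = beta f (Suc j)" if "i \<le> j" "j < k" for j
    using r that by (auto simp: ribbon_def beta_def)
  have same: "beta g j = beta f j" if "j < i \<or> k < j" for j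
  proof -
    have "g j = f j" using r that unfolding ribbon_def by blast
    then show ?thesis by (simp add: beta_def)
  qed
  have ik: "i \<le> k" using r by (simp add: ribbon_def)
  show nin: "beta g k \<notin> range (beta f)"
  proof
    assume "beta g k \<in> range (beta f)"
    then obtain j where j: "beta g k = beta f j" by auto
    then have "k < j" using pos[of j] by auto
    moreover have "j < Suc k" using gt j beta_less_iff[OF f] by metis
    ultimately show False by simp
  qed
  show "range (beta g) = insert (beta g k) (range (beta f) - {beta f i})"
  proof (rule set_eqI, rule iffI)
    fix z assume "z \<in> range (beta g)"
    then obtain j where j: "z = beta g j" by auto
    consider "j = k" | "j < i \<or> k < j" | "i \<le> j" "j < k" by linarith
    then show "z \<in> insert (beta g k) (range (beta f) - {beta f i})"
    proof cases
      case 2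
      then have "beta f j \<noteq> beta f i" using beta_less[OF f, of j i] beta_less[OF f, of i j] ik by auto
      then show ?thesis using same[OF 2] j by auto
    next
      case 3
      then have "beta f (Suc j) \<noteq> beta f i" using beta_less[OF f, of i "Suc j"] by auto
      then show ?thesis using shift[OF 3] j by auto
    qed (use j in auto)
  next
    fix z assume "z \<in> insert (beta g k) (range (beta f) - {beta f i})"
    then consider "z = beta g k" | j where "z = beta f j" "j \<noteq> i" by auto
    then show "z \<in> range (beta g)"
    proof cases
      case (2 j)
      show ?thesis
      proof (cases "j < i \<or> k < j")
        case True
        then show ?thesis using same 2 by (metis rangeI)
      next
        case False
        then obtain j' where "j = Suc j'" "i \<le> j'" "j' < k" using 2(2) by (cases j) auto
        then show ?thesis using shift 2 by (metis rangeI)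
      qed
    qed auto
  qed
  show "range (beta f) \<inter> {beta g k<..<beta f i} = {} \<longleftrightarrow> i = k"
  proof
    assume e: "range (beta f) \<inter> {beta g k<..<beta f i} = {}"
    show "i = k"
    proof (rule ccontr)
      assume "i \<noteq> k"
      then have "beta f k \<in> range (beta f) \<inter> {beta g k<..<beta f i}"
        using lt beta_less[OF f, of i k] ik by auto
      then show False using e by auto
    qed
  next
    assume "i = k"
    then show "range (beta f) \<inter> {beta g k<..<beta f i} = {}"
      using pos beta_less_iff[OF f] by (auto) (metis leD pos)
  qed
qed

text \<open>The end row \<open>k\<close> must be the last one whose bead exceeds the target
  position; the ribbon conditions and the target then determine \<open>g\<close>.\<close>

lemma ribbon_exists:
  assumes f: "antimono f" and l: "l > 0" and nin: "beta f i - int l \<notin> range (beta f)"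
  obtains g k where "antimono g" "ribbon f g i k" "beta g k = beta f i - int l"
proof -
  define t where "t = beta f i - int l"
  have ex: "\<exists>j. beta f (Suc j) < t" by (rule beta_unbounded[OF f])
  define k where "k = (LEAST j. beta f (Suc j) < t)"
  have k: "beta f (Suc k) < t" unfolding k_def using ex by (rule LeastI_ex)
  have ti: "t < beta f i" using l by (simp add: t_def)
  have "i < Suc k" using k ti beta_less_iff[OF f, of "Suc k" i] by simp
  then have ik: "i \<le> k" by simp
  have "t < beta f k"
  proof (cases "k = i")
    case False
    then obtain j where j: "k = Suc j" using ik by (cases k) auto
    then have "\<not> beta f (Suc j) < t" using not_less_Least[of j "\<lambda>j. beta f (Suc j) < t"] k_def by simp
    moreover have "beta f (Suc j) \<noteq> t" using nin t_def by (metis rangeI)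
    ultimately show ?thesis using j by simp
  qed (use ti in simp)
  then have tk: "t + int k < int (f k)" by (simp add: beta_def)
  have tk1: "int (f (Suc k)) \<le> t + int k" using k by (simp add: beta_def)
  \<comment> \<open>Row \<open>k\<close> gets the length that puts its bead at \<open>t\<close>.
    Neither \<open>- 1\<close> nor \<open>nat\<close> truncates: \<open>f\<close> is positive up to
    row \<open>k\<close>, and \<open>t + k\<close> is at least \<open>f (Suc k)\<close>.\<close>
  define g where "g j = (if i \<le> j \<and> j < k then f (Suc j) - 1 else if j = k then nat (t + int k) else f j)" for j
  have gk: "int (g k) = t + int k" using tk1 by (simp add: g_def)
  have pos: "f j > 0" if "j \<le> k" for j
    using antimonoD[OF f that] tk tk1 by linarith
  have r: "ribbon f g i k"
    unfolding ribbon_def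
  proof (intro conjI allI impI)
    show "g k < f k" using gk tk by simp
  qed (use ik pos in \<open>auto simp: g_def\<close>)
  have step: "f (Suc j) \<le> f j" for j using antimonoD[OF f, of j "Suc j"] by simp
  have "g (Suc j) \<le> g j" for j
  proof -
    consider "Suc j < i \<or> k < j" | "Suc j = i" | "i \<le> j" "Suc j < k" | "i \<le> j" "Suc j = k" | "j = k"
      by linarith
    then show ?thesis
    proof cases
      case 1
      then show ?thesis using step[of j] ik by (auto simp: g_def)
    next
      case 2
      then have "g j = f j" using ik by (simp add: g_def)
      moreover have "g i < f i" using ribbon_less[OF f r] ik by simp
      ultimately show ?thesis using step[of j] 2 by simp
    next
      case 3
      then show ?thesis using step[of "Suc j"] by (simp add: g_def diff_le_mono)
    next
      case 4
      then have "g j = f k - 1" by (auto simp: g_def)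
      then show ?thesis using gk tk 4 by simp
    next
      case 5
      then have "g (Suc j) = f (Suc k)" using ik by (simp add: g_def)
      then show ?thesis using gk tk1 5 by simp
    qed
  qed
  then have "antimono g" by (simp add: antimono_iff_le_Suc)
  moreover have "beta g k = beta f i - int l" using gk by (simp add: beta_def t_def)
  ultimately show thesis using that r by blast
qed

section \<open>Ribbons as sets of boxes\<close>

lemma ribbon_diagram:
  assumes "antimono (part lam)" "ribbon (part lam) (part mu) i k"
  shows "young_diagram lam - young_diagram mu =
    Sigma {Suc i..Suc k} (\<lambda>x. {part mu (x - 1)<..part lam (x - 1)})"
proof -
  have same: "part mu j = part lam j" if "\<not> (i \<le> j \<and> j \<le> k)" for j
    using assms(2) that unfolding ribbon_def by (meson not_le)
  have rows: "i \<le> j \<and> j \<le> k" if "part mu j < y" "y \<le> part lam j" for j y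
    using same[of j] that by linarith
  have "(x, y) \<in> young_diagram lam - young_diagram mu \<longleftrightarrow>
      (x, y) \<in> Sigma {Suc i..Suc k} (\<lambda>x. {part mu (x - 1)<..part lam (x - 1)})" for x y
    using rows[of "x - 1" y] by (cases x) (auto simp: mem_young_diagram)
  then show ?thesis by (intro set_eqI) (simp only: split_paired_all)
qed

text \<open>The sum telescopes: each \<open>g j\<close> with \<open>j < k\<close> cancels
  \<open>f (Suc j)\<close> up to 1, and these \<open>k - i\<close> units are the difference of the
  row offsets in \<open>beta\<close>.\<close>

lemma ribbon_diff_sum:
  fixes f g :: "nat \<Rightarrow> nat"
  assumes "i \<le> k" "\<And>j. i \<le> j \<Longrightarrow> j < k \<Longrightarrow> Suc (g j) = f (Suc j)"
  shows "(\<Sum>j=i..k. int (f j) - int (g j)) = beta f i - beta g k"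
  using assms
proof (induction k rule: dec_induct)
  case base
  then show ?case by (simp add: beta_def)
next
  case (step n)
  have "int (g n) + 1 = int (f (Suc n))" using step(4)[of n] step(1) by simp
  then show ?case using step by (simp add: beta_def)
qed

lemma ribbon_card:
  assumes "antimono (part lam)" and r: "ribbon (part lam) (part mu) i k"
  shows "int (card (young_diagram lam - young_diagram mu)) = beta (part lam) i - beta (part mu) k"
proof -
  have "card (young_diagram lam - young_diagram mu) =
      (\<Sum>x\<in>{Suc i..Suc k}. part lam (x - 1) - part mu (x - 1))"
    by (simp add: ribbon_diagram[OF assms])
  also have "\<dots> = (\<Sum>j=i..k. part lam j - part mu j)"
    by (subst sum.shift_bounds_cl_Suc_ivl) simp
  finally have "int (card (young_diagram lam - young_diagram mu)) =
      (\<Sum>j=i..k. int (part lam j - part mu j))" by simp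
  also have "\<dots> = (\<Sum>j=i..k. int (part lam j) - int (part mu j))"
    using ribbon_less[OF assms] by (intro sum.cong) (auto simp: of_nat_diff less_imp_le)
  also have "\<dots> = beta (part lam) i - beta (part mu) k"
    using r by (intro ribbon_diff_sum) (auto simp: ribbon_def)
  finally show ?thesis .
qed

text \<open>Every row from \<open>i\<close> to \<open>k\<close> loses at least its last box.\<close>

lemma ribbon_horizontal:
  assumes f: "antimono (part lam)" and r: "ribbon (part lam) (part mu) i k"
  shows "horizontal (young_diagram lam - young_diagram mu) \<longleftrightarrow> i = k"
proof -
  have ik: "i \<le> k" using r by (simp add: ribbon_def)
  have mem: "(Suc j, part lam j) \<in> young_diagram lam - young_diagram mu" if "i \<le> j" "j \<le> k" for j
    using that ribbon_less[OF f r that] unfolding ribbon_diagram[OF f r] by simp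
  have "i = k" if "horizontal (young_diagram lam - young_diagram mu)"
  proof -
    obtain x where "\<forall>p\<in>young_diagram lam - young_diagram mu. fst p = x"
      using \<open>horizontal _\<close> unfolding horizontal_def by (elim exE)
    from bspec[OF this mem[of i]] bspec[OF this mem[of k]] show ?thesis using ik by simp
  qed
  moreover have "i = k \<Longrightarrow> horizontal (young_diagram lam - young_diagram mu)"
    unfolding ribbon_diagram[OF f r] horizontal_def by auto
  ultimately show ?thesis by blast
qed

text \<open>From any box, walk right to the end of the row. The box above that end is the leftmost
  ribbon box of the previous row, so one can step up and repeat. All walks meet in the last box of
  the top row.\<close>

lemma ribbon_connected:
  assumes f: "antimono (part lam)" and r: "ribbon (part lam) (part mu) i k"
  shows "connected_boxes (young_diagram lam - young_diagram mu)"
proof -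
  let ?f = "part lam" and ?g = "part mu"
  define S where "S = young_diagram lam - young_diagram mu"
  have mem: "(Suc j, y) \<in> S \<longleftrightarrow> i \<le> j \<and> j \<le> k \<and> ?g j < y \<and> y \<le> ?f j" for j y
    unfolding S_def ribbon_diagram[OF f r] by auto
  let ?E = "adjacent \<inter> S \<times> S"
  have row: "((Suc j, y), (Suc j, ?f j)) \<in> ?E\<^sup>*" if "(Suc j, y) \<in> S" for j y
  proof -
    from that have "y \<le> ?f j" by (simp add: mem)
    then show ?thesis using that
    proof (induction y rule: inc_induct)
      case (step n)
      then have "(Suc j, Suc n) \<in> S" by (simp add: mem)
      moreover from this have "((Suc j, n), (Suc j, Suc n)) \<in> ?E"
        using step by (simp add: adjacent_def)
      ultimately show ?case using step.IH by (meson converse_rtrancl_into_rtrancl)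
    qed simp
  qed
  have corner: "((Suc j, y), (Suc i, ?f i)) \<in> ?E\<^sup>*" if "(Suc j, y) \<in> S" for j y
  proof -
    from that have "i \<le> j" by (simp add: mem)
    then show ?thesis using that
    proof (induction j arbitrary: y rule: dec_induct)
      case base
      then show ?case by (rule row)
    next
      case (step j)
      have j: "i \<le> j" "j < k" using step.prems step.hyps by (auto simp: mem)
      then have gj: "Suc (?g j) = ?f (Suc j)" using r by (simp add: ribbon_def)
      have s: "(Suc j, ?f (Suc j)) \<in> S" "(Suc (Suc j), ?f (Suc j)) \<in> S"
        using j gj step.prems antimonoD[OF f, of j "Suc j"] by (auto simp: mem)
      then have "((Suc (Suc j), ?f (Suc j)), (Suc j, ?f (Suc j))) \<in> ?E"
        by (simp add: adjacent_def)
      then show ?case using row[OF step.prems] step.IH[OF s(1)]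
        by (meson converse_rtrancl_into_rtrancl rtrancl_trans)
    qed
  qed
  have "sym ?E" by (auto simp: sym_def adjacent_def)
  then have sym: "sym (?E\<^sup>*)" by (rule sym_rtrancl)
  have to: "(p, (Suc i, ?f i)) \<in> ?E\<^sup>*" if "p \<in> S" for p
  proof -
    obtain x y where p: "p = (x, y)" by (cases p)
    with that have "x \<noteq> 0" by (auto simp: S_def mem_young_diagram)
    with p obtain j where "p = (Suc j, y)" by (cases x) auto
    then show ?thesis using corner that by blast
  qed
  show ?thesis
    unfolding connected_boxes_def S_def[symmetric]
    using to sym by (meson rtrancl_trans symD)
qed

text \<open>Consecutive rows share a single column, whereas a square needs two.\<close>

lemma ribbon_no_square:
  assumes f: "antimono (part lam)" and r: "ribbon (part lam) (part mu) i k"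
  shows "\<not> contains_square (young_diagram lam - young_diagram mu)"
proof
  assume "contains_square (young_diagram lam - young_diagram mu)"
  then obtain x y where
    "(x, y) \<in> young_diagram lam - young_diagram mu"
    "(Suc x, Suc y) \<in> young_diagram lam - young_diagram mu"
    unfolding contains_square_def by blast
  then have h: "Suc i \<le> x" "x \<le> k" "part mu (x - 1) < y" "Suc y \<le> part lam x"
    unfolding ribbon_diagram[OF f r] by auto
  then obtain j where "x = Suc j" by (cases x) auto
  then show False using h r by (auto simp: ribbon_def)
qed

lemma ribbon_rim_hook:
  assumes "is_partition lam" "is_partition mu" "ribbon (part lam) (part mu) i k"
    and "beta (part mu) k = beta (part lam) i - int l"
  shows "rim_hook l lam (young_diagram lam - young_diagram mu)"
    and "young_diagram mu = young_diagram lam - (young_diagram lam - young_diagram mu)"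
proof -
  have f: "antimono (part lam)" using part_antimono assms by blast
  have "part mu j \<le> part lam j" for j
    using assms(3) ribbon_less[OF f assms(3), of j] by (cases "i \<le> j \<and> j \<le> k") (auto simp: ribbon_def less_imp_le)
  then have "young_diagram mu \<subseteq> young_diagram lam"
    by (auto simp: mem_young_diagram) (meson order_trans)
  then show eq: "young_diagram mu = young_diagram lam - (young_diagram lam - young_diagram mu)"
    by blast
  have "card (young_diagram lam - young_diagram mu) = l"
    using ribbon_card[OF f assms(3)] assms(4) by simp
  then show "rim_hook l lam (young_diagram lam - young_diagram mu)"
    unfolding rim_hook_def
    using ribbon_connected[OF f assms(3)] ribbon_no_square[OF f assms(3)] assms(2) eq by blast
qed

section \<open>Correspondence between rim hooks and bead moves\<close>

text \<open>A path changes its row only by vertical steps of length one, so somewhere it steps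
  straight from row \<open>x\<close> to the next.\<close>

lemma connected_crossing:
  assumes c: "connected_boxes S" and p: "p \<in> S" "fst p \<le> x" and q: "q \<in> S" "x < fst q"
  shows "\<exists>y. (x, y) \<in> S \<and> (Suc x, y) \<in> S"
proof (rule ccontr)
  assume H: "\<not> ?thesis"
  have "(p, q) \<in> (adjacent \<inter> S \<times> S)\<^sup>*" using c p q by (simp add: connected_boxes_def)
  then have "fst q \<le> x"
  proof (induction rule: rtrancl_induct)
    case (step u v)
    show ?case
    proof (rule ccontr)
      assume "\<not> fst v \<le> x"
      then have "fst u = x" "fst v = Suc x" "snd u = snd v"
        using step by (auto simp: adjacent_def)
      then show False using H step.hyps by (metis IntD2 SigmaE2 prod.collapse)
    qed
  qed (rule p)
  then show False using q by simp
qed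

text \<open>Take \<open>i\<close> and \<open>k\<close> as the first and last row that lose boxes.
  Connectedness forces consecutive rows to share at least one column, absence of squares at most
  one.\<close>

lemma rim_hook_ribbon:
  assumes lam: "is_partition lam" and mu: "is_partition mu"
    and S: "rim_hook l lam S" and eq: "young_diagram mu = young_diagram lam - S" and l: "l > 0"
  obtains i k where "ribbon (part lam) (part mu) i k"
proof -
  let ?f = "part lam" and ?g = "part mu"
  have sub: "S \<subseteq> young_diagram lam" and card: "card S = l" and con: "connected_boxes S"
    and sq: "\<not> contains_square S" using S by (auto simp: rim_hook_def)
  have Seq: "S = young_diagram lam - young_diagram mu" using sub eq by blast
  have f: "antimono ?f" and g: "antimono ?g" using part_antimono lam mu by auto
  have mem: "(Suc j, y) \<in> S \<longleftrightarrow> ?g j < y \<and> y \<le> ?f j" for j y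
    by (auto simp: Seq mem_young_diagram)
  have le: "?g j \<le> ?f j" for j
  proof (cases "?g j")
    case (Suc n)
    then have "(Suc j, ?g j) \<in> young_diagram mu" by (simp add: mem_young_diagram)
    then show ?thesis using eq by (simp add: mem_young_diagram)
  qed simp
  define R where "R = {j. ?g j < ?f j}"
  have "R \<subseteq> {..<length lam}" by (auto simp: R_def part_def split: if_splits)
  then have fin: "finite R" using finite_subset by blast
  have "S \<noteq> {}" using card l by auto
  then obtain x y where xy: "(x, y) \<in> S" by auto
  then obtain j where "x = Suc j" using sub by (cases x) (auto simp: mem_young_diagram)
  then have ne: "R \<noteq> {}" using xy mem R_def by fastforce
  define i where "i = Min R"
  define k where "k = Max R"
  have iR: "i \<in> R" and kR: "k \<in> R" using fin ne by (auto simp: i_def k_def)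
  then have iS: "(Suc i, ?f i) \<in> S" and kS: "(Suc k, ?f k) \<in> S" by (auto simp: mem R_def)
  have ik: "i \<le> k" using fin iR by (simp add: k_def)
  have "?g j = ?f j" if "j < i \<or> k < j" for j
  proof -
    have "j \<notin> R" using that Min_le[OF fin, of j] Max_ge[OF fin, of j] unfolding i_def k_def
      by linarith
    then show ?thesis using le[of j] by (simp add: R_def)
  qed
  moreover have "Suc (?g j) = ?f (Suc j)" if j: "i \<le> j" "j < k" for j
  proof -
    obtain y where "(Suc j, y) \<in> S" "(Suc (Suc j), y) \<in> S"
      using connected_crossing[OF con iS _ kS, of "Suc j"] j by auto
    then have lt: "?g j < ?f (Suc j)" by (auto simp: mem)
    have m: "?f (Suc j) \<le> ?f j" "?g (Suc j) \<le> ?g j"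
      using antimonoD[OF f, of j "Suc j"] antimonoD[OF g, of j "Suc j"] by auto
    \<comment> \<open>Otherwise the first two removed boxes of row \<open>j\<close> and the boxes
      below them form a square in \<open>S\<close>.\<close>
    have "\<not> Suc (Suc (?g j)) \<le> ?f (Suc j)"
    proof
      assume "Suc (Suc (?g j)) \<le> ?f (Suc j)"
      then have "{(Suc j, Suc (?g j)), (Suc j, Suc (Suc (?g j))),
         (Suc (Suc j), Suc (?g j)), (Suc (Suc j), Suc (Suc (?g j)))} \<subseteq> S"
        using m by (auto simp: mem)
      then show False using sq unfolding contains_square_def by blast
    qed
    then show ?thesis using lt by simp
  qed
  ultimately have "ribbon ?f ?g i k" using ik kR by (simp add: ribbon_def R_def)
  then show thesis by (rule that)
qed

lemma rim_hook_maya: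
  assumes lam: "is_partition lam" and mu: "is_partition mu"
    and S: "rim_hook l lam S" and eq: "young_diagram mu = young_diagram lam - S" and l: "l > 0"
  obtains b where "b \<in> maya lam" "b - int l \<notin> maya lam" "maya mu = move l b (maya lam)"
    "horizontal S \<longleftrightarrow> maya lam \<inter> {b - int l<..<b} = {}"
proof -
  obtain i k where r: "ribbon (part lam) (part mu) i k" using rim_hook_ribbon[OF assms] .
  have f: "antimono (part lam)" and g: "antimono (part mu)" using part_antimono lam mu by auto
  have Seq: "S = young_diagram lam - young_diagram mu" and "card S = l"
    using S eq by (auto simp: rim_hook_def)
  then have "beta (part mu) k = beta (part lam) i - int l" using ribbon_card[OF f r] by simp
  then show thesis
    using ribbon_beta[OF f g r] ribbon_horizontal[OF f r] Seq
    by (intro that[of "beta (part lam) i"]) (simp_all add: maya_def move_def)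
qed

lemma maya_rim_hook:
  assumes lam: "is_partition lam" and l: "l > 0" and b: "b \<in> maya lam" "b - int l \<notin> maya lam"
  obtains S mu where "is_partition mu" "rim_hook l lam S" "young_diagram mu = young_diagram lam - S"
    "maya mu = move l b (maya lam)" "horizontal S \<longleftrightarrow> maya lam \<inter> {b - int l<..<b} = {}"
proof -
  have f: "antimono (part lam)" using part_antimono lam by auto
  obtain i where i: "b = beta (part lam) i" using b by (auto simp: maya_def)
  obtain g k where g: "antimono g" and r: "ribbon (part lam) g i k"
    and t: "beta g k = beta (part lam) i - int l"
    using ribbon_exists[OF f l] b i unfolding maya_def by metis
  \<comment> \<open>A row below both the ribbon and the diagram, where \<open>g\<close>
    vanishes.\<close>
  let ?n = "Suc (k + length lam)"
  have "g ?n = part lam ?n" using r by (simp add: ribbon_def)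
  then have "g ?n = 0" by (simp add: part_def)
  then obtain mu where mu: "is_partition mu" "part mu = g" using exists_partition[OF g] by blast
  have r': "ribbon (part lam) (part mu) i k" using r mu by simp
  show thesis
    using ribbon_rim_hook[OF lam mu(1) r'] ribbon_beta[OF f _ r'] ribbon_horizontal[OF f r'] t g i mu
    by (intro that[of mu "young_diagram lam - young_diagram mu"]) (simp_all add: maya_def move_def)
qed

section \<open>Columns as gaps, hook lengths as differences\<close>

text \<open>The number of boxes in column \<open>c\<close>; unspecified for \<open>c = 0\<close>, which is not a column.\<close>

definition column :: "nat list \<Rightarrow> nat \<Rightarrow> nat" where
  "column lam c = (LEAST i. part lam i < c)"

lemma less_column_iff:
  assumes "is_partition lam" "c \<ge> 1"
  shows "i < column lam c \<longleftrightarrow> c \<le> part lam i"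
proof
  assume "i < column lam c"
  then show "c \<le> part lam i" unfolding column_def using not_less_Least not_less by blast
next
  assume c: "c \<le> part lam i"
  \<comment> \<open>The minimum exists because the row after the last part is empty and
    \<open>c\<close> is positive.\<close>
  have "part lam (column lam c) < c" unfolding column_def
    by (rule LeastI[of _ "length lam"]) (use assms in \<open>simp add: part_length\<close>)
  then show "i < column lam c"
    using antimonoD[OF part_antimono[OF assms(1)], of "column lam c" i] c by (meson leD leI order_trans)
qed

text \<open>Arm with corner has \<open>part lam (a - 1) - c + 1\<close> boxes, the leg
  \<open>column lam c - a\<close>. Regrouping separates the bead of the row from a number depending
  on the column alone.\<close>

lemma hook_length_eq:
  assumes lam: "is_partition lam" and a: "(a, c) \<in> young_diagram lam"
  shows "int (hook_length lam (a, c)) = beta (part lam) (a - 1) - (int c - int (column lam c))"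
proof -
  have a1: "1 \<le> a" "1 \<le> c" "c \<le> part lam (a - 1)" using a by (auto simp: mem_young_diagram)
  then have col: "a - 1 < column lam c" using less_column_iff[OF lam] by blast
  have "hook lam (a, c) = {a} \<times> {c..part lam (a - 1)} \<union> {a<..column lam c} \<times> {c}"
  proof -
    have "(x, y) \<in> hook lam (a, c) \<longleftrightarrow>
        (x, y) \<in> {a} \<times> {c..part lam (a - 1)} \<union> {a<..column lam c} \<times> {c}" for x y
    proof (cases "x = a")
      case True
      then show ?thesis using a1 by (auto simp: hook_def mem_young_diagram)
    next
      case False
      have "1 \<le> x \<Longrightarrow> c \<le> part lam (x - 1) \<longleftrightarrow> x \<le> column lam c"
        using less_column_iff[OF lam a1(2), of "x - 1"] by linarith
      then show ?thesis using False a1(1,2) unfolding hook_def mem_young_diagram by auto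
    qed
    then show ?thesis by (intro set_eqI) (simp only: split_paired_all)
  qed
  then have "hook_length lam (a, c) = card ({a} \<times> {c..part lam (a - 1)}) + card ({a<..column lam c} \<times> {c})"
    unfolding hook_length_def by (simp only:) (rule card_Un_disjoint, auto)
  then have "hook_length lam (a, c) = Suc (part lam (a - 1)) - c + (column lam c - a)"
    by (simp add: card_cartesian_product)
  then show ?thesis using a1 col by (simp add: beta_def)
qed

text \<open>For a gap \<open>x\<close>, let \<open>i\<close> be the first row with bead below
  \<open>x\<close>; then column \<open>x + i\<close> has exactly \<open>i\<close> boxes. Conversely,
  a row reaching column \<open>c\<close> has its bead above \<open>c - column lam c\<close>, and any
  other row has it below.\<close>

lemma maya_gap_iff:
  assumes lam: "is_partition lam"
  shows "x \<notin> maya lam \<longleftrightarrow> (\<exists>c\<ge>1. x = int c - int (column lam c))"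
proof
  assume x: "x \<notin> maya lam"
  have f: "antimono (part lam)" using part_antimono lam by auto
  let ?P = "\<lambda>i. beta (part lam) i < x"
  define i where "i = (LEAST i. ?P i)"
  have "\<exists>i. ?P i" using beta_unbounded[OF f] by blast
  then have i: "?P i" unfolding i_def by (rule LeastI_ex)
  then have lt: "int (part lam i) < x + int i" by (simp add: beta_def)
  define c where "c = nat (x + int i)"
  have c: "int c = x + int i" "c \<ge> 1" using lt by (auto simp: c_def)
  have "\<not> i < column lam c" using less_column_iff[OF lam c(2)] lt c(1) by simp
  moreover have "j < column lam c" if j: "j < i" for j
  proof -
    obtain m where m: "i = Suc m" using j by (cases i) auto
    have "\<not> ?P m" using not_less_Least[of m ?P] m i_def by simp
    moreover have "beta (part lam) m \<noteq> x" using x by (auto simp: maya_def)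
    ultimately have "c \<le> part lam m" using m c by (simp add: beta_def)
    also have "\<dots> \<le> part lam j" using antimonoD[OF f, of j m] j m by simp
    finally show ?thesis using less_column_iff[OF lam c(2)] by blast
  qed
  ultimately have "column lam c = i" by (meson less_irrefl linorder_neqE_nat)
  then show "\<exists>c\<ge>1. x = int c - int (column lam c)" using c by (intro exI[of _ c]) simp
next
  assume "\<exists>c\<ge>1. x = int c - int (column lam c)"
  then obtain c where c: "c \<ge> 1" "x = int c - int (column lam c)" by blast
  have "beta (part lam) i \<noteq> x" for i
    using less_column_iff[OF lam c(1), of i] c(2) unfolding beta_def by linarith
  then show "x \<notin> maya lam" by (auto simp: maya_def)
qed

lemma box_iff_above_gap:
  assumes "is_partition lam" "c \<ge> 1"
  shows "(Suc i, c) \<in> young_diagram lam \<longleftrightarrow> int c - int (column lam c) < beta (part lam) i"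
  using less_column_iff[OF assms, of i] assms(2) by (simp add: mem_young_diagram beta_def) linarith

text \<open>Columns are gaps, the boxes of a column are the beads above its gap, and hook lengths
  are the differences, so both sides compare the same divisibilities.\<close>

lemma hook_condition_iff_congruent_above:
  assumes lam: "is_partition lam"
  shows "(\<forall>a b c. (a, c) \<in> young_diagram lam \<and> (b, c) \<in> young_diagram lam \<longrightarrow>
       nu l (int (hook_length lam (a, c))) = nu l (int (hook_length lam (b, c)))) \<longleftrightarrow>
     congruent_above l (maya lam)" (is "?H \<longleftrightarrow> _")
proof
  assume H: ?H
  show "congruent_above l (maya lam)"
    unfolding congruent_above_def
  proof (intro allI impI ballI)
    fix x b d assume x: "x \<notin> maya lam" and b: "b \<in> maya lam" "x < b" and d: "d \<in> maya lam" "x < d"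
    obtain c where c: "c \<ge> 1" "x = int c - int (column lam c)" using x maya_gap_iff[OF lam] by blast
    obtain i j where ij: "b = beta (part lam) i" "d = beta (part lam) j"
      using b d by (auto simp: maya_def)
    have m: "(Suc i, c) \<in> young_diagram lam" "(Suc j, c) \<in> young_diagram lam"
      using box_iff_above_gap[OF lam c(1)] b d c ij by auto
    have "nu l (int (hook_length lam (Suc i, c))) = nu l (int (hook_length lam (Suc j, c)))"
      by (rule H[rule_format, OF conjI[OF m]])
    then show "int l dvd b - x \<longleftrightarrow> int l dvd d - x"
      unfolding hook_length_eq[OF lam m(1)] hook_length_eq[OF lam m(2)] c(2) ij diff_Suc_1
      by (simp add: nu_def split: if_splits)
  qed
next
  assume C: "congruent_above l (maya lam)"
  show ?H
  proof (intro allI impI, elim conjE)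
    fix a b c assume m: "(a, c) \<in> young_diagram lam" "(b, c) \<in> young_diagram lam"
    then obtain i j where ij: "a = Suc i" "b = Suc j" and c: "c \<ge> 1"
      by (cases a; cases b) (auto simp: mem_young_diagram)
    let ?x = "int c - int (column lam c)"
    have "?x \<notin> maya lam" using maya_gap_iff[OF lam] c by blast
    moreover have "?x < beta (part lam) i" "?x < beta (part lam) j"
      using box_iff_above_gap[OF lam c] m ij by auto
    ultimately have "int l dvd beta (part lam) i - ?x \<longleftrightarrow> int l dvd beta (part lam) j - ?x"
      using C unfolding congruent_above_def maya_def by blast
    then show "nu l (int (hook_length lam (a, c))) = nu l (int (hook_length lam (b, c)))"
      unfolding hook_length_eq[OF lam m(1)] hook_length_eq[OF lam m(2)] unfolding ij diff_Suc_1
      by (simp add: nu_def)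
  qed
qed

section \<open>Regularity and the two implications\<close>

text \<open>Equal parts \<open>k\<close> give adjacent beads above the gap of column
  \<open>k\<close>. Among \<open>l\<close> of them one is congruent to the gap, hence all are, but
  neighbours differ by 1.\<close>

lemma congruent_above_regular:
  assumes lam: "is_partition lam" and l: "l \<ge> 2" and C: "congruent_above l (maya lam)"
  shows "regular l lam"
  unfolding regular_def
proof
  assume "\<exists>k>0. count_list lam k \<ge> l"
  then obtain k where k: "k > 0" "count_list lam k \<ge> l" by blast
  have f: "antimono (part lam)" using part_antimono lam by auto
  define R where "R = {i. i < length lam \<and> lam ! i = k}"
  have card: "card R \<ge> l"
    using k by (simp add: R_def count_list_eq_length_filter length_filter_conv_card eq_commute)
  have fin: "finite R" by (simp add: R_def)
  have ne: "R \<noteq> {}" using card l by auto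
  have val: "part lam i = k" if "i \<in> R" for i using that by (simp add: R_def part_def)
  have "R \<subseteq> {Min R..Max R}" using fin by auto
  then have "card R \<le> Suc (Max R) - Min R" using card_mono[of "{Min R..Max R}" R] by simp
  then have top: "Min R + (l - 1) \<le> Max R" using card l by linarith
  define m where "m = Min R"
  \<comment> \<open>These rows lie between the first and the last row of length
    \<open>k\<close>.\<close>
  have run: "part lam (m + j) = k" if "j < l" for j
  proof (rule antisym)
    have "part lam (m + j) \<le> part lam m" using antimonoD[OF f] by simp
    then show "part lam (m + j) \<le> k" using val fin ne by (simp add: m_def)
    have "part lam (Max R) \<le> part lam (m + j)"
      using antimonoD[OF f, of "m + j" "Max R"] top that by (simp add: m_def)
    then show "k \<le> part lam (m + j)" using val fin ne by simp
  qed
  define x where "x = int k - int (column lam k)"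
  define b where "b = int k - int m"
  have x: "x \<notin> maya lam" unfolding maya_gap_iff[OF lam] x_def
    by (rule exI[of _ k]) (use k in simp)
  have mem: "b - int j \<in> maya lam \<and> x < b - int j" if "j < l" for j
  proof -
    have e: "beta (part lam) (m + j) = b - int j" using run[OF that] by (simp add: beta_def b_def)
    have "m + j < column lam k" using less_column_iff[OF lam, of k "m + j"] k run[OF that] by simp
    moreover have "b - int j \<in> maya lam" unfolding maya_def using e by (metis rangeI)
    ultimately show ?thesis by (simp add: x_def b_def)
  qed
  have same: "int l dvd b - int j - x \<longleftrightarrow> int l dvd b - int j' - x" if "j < l" "j' < l" for j j'
    using mem[OF that(1)] mem[OF that(2)] C x unfolding congruent_above_def by blast
  \<comment> \<open>Chosen so that the bead \<open>b - r\<close> is congruent to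
    \<open>x\<close>.\<close>
  define r where "r = nat ((b - x) mod int l)"
  have r: "int r = (b - x) mod int l" "r < l" using l by (auto simp: r_def nat_less_iff)
  have "int l dvd (b - x) - (b - x) mod int l" by (rule dvd_minus_mod)
  then have "int l dvd b - int r - x" using r by (simp add: algebra_simps)
  then have d: "int l dvd b - int 0 - x" "int l dvd b - int 1 - x"
    using same[of r 0] same[of r 1] r l by auto
  then have "int l dvd (b - int 0 - x) - (b - int 1 - x)" by (rule dvd_diff)
  then show False using l by simp
qed

lemma congruent_above_no_non_horizontal:
  assumes "is_partition lam" "l > 0" "congruent_above l (maya lam)"
  shows "no_non_horizontal l lam"
  unfolding no_non_horizontal_def
proof
  assume "\<exists>S. rim_hook l lam S \<and> \<not> horizontal S"
  then obtain S mu where S: "rim_hook l lam S" "\<not> horizontal S"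
    and mu: "is_partition mu" "young_diagram mu = young_diagram lam - S"
    by (auto simp: rim_hook_def)
  then show False
    using rim_hook_maya[OF assms(1) mu(1) S(1) mu(2) assms(2)]
      congruent_above_no_between[OF assms(3)] by metis
qed

lemma congruent_above_remove_horizontal:
  assumes "(remove_horizontal l)\<^sup>*\<^sup>* lam mu" "is_partition lam" "l > 0" "congruent_above l (maya lam)"
  shows "is_partition mu \<and> congruent_above l (maya mu)"
  using assms(1)
proof induction
  case (step mu nu)
  then obtain S where "rim_hook l mu S" "is_partition nu" "young_diagram nu = young_diagram mu - S"
    by (auto simp: remove_horizontal_def)
  then show ?case
    using rim_hook_maya[of mu nu l S] step.IH assms(3) congruent_above_move by metis
qed (use assms in simp)

text \<open>Each movable bead yields a rim hook, horizontal by hypothesis. Its removal leaves a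
  smaller partition, and whatever is reachable from there is reachable from \<open>lam\<close>, so
  the hypothesis is inherited and \<open>congruent_above_from_moves\<close> applies.\<close>

lemma no_non_horizontal_congruent_above:
  assumes "is_partition lam" "l > 0"
    and "\<And>mu. (remove_horizontal l)\<^sup>*\<^sup>* lam mu \<Longrightarrow> no_non_horizontal l mu"
  shows "congruent_above l (maya lam)"
  using assms(1,3)
proof (induction "card (young_diagram lam)" arbitrary: lam rule: less_induct)
  case less
  have hook: "\<exists>S mu. horizontal S \<and> is_partition mu \<and> rim_hook l lam S \<and>
      young_diagram mu = young_diagram lam - S \<and> maya mu = move l b (maya lam) \<and>
      maya lam \<inter> {b - int l<..<b} = {}"
    if b: "b \<in> maya lam" "b - int l \<notin> maya lam" for b
  proof -
    obtain S mu where S: "is_partition mu" "rim_hook l lam S" "young_diagram mu = young_diagram lam - S"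
      "maya mu = move l b (maya lam)" "horizontal S \<longleftrightarrow> maya lam \<inter> {b - int l<..<b} = {}"
      using maya_rim_hook[OF less.prems(1) assms(2) b] .
    moreover have "no_non_horizontal l lam" using less.prems(2) by blast
    ultimately show ?thesis unfolding no_non_horizontal_def by blast
  qed
  show ?case
  proof (rule congruent_above_from_moves[OF assms(2)])
    fix b assume b: "b \<in> maya lam" "b - int l \<notin> maya lam"
    show "maya lam \<inter> {b - int l<..<b} = {}" using hook[OF b] by blast
    obtain S mu where S: "horizontal S" "is_partition mu" "rim_hook l lam S"
      "young_diagram mu = young_diagram lam - S" "maya mu = move l b (maya lam)"
      using hook[OF b] by blast
    then have rem: "remove_horizontal l lam mu" unfolding remove_horizontal_def by blast
    have "S \<subseteq> young_diagram lam" "S \<noteq> {}" using S(3) assms(2) by (auto simp: rim_hook_def)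
    then have "young_diagram mu \<subset> young_diagram lam" using S(4) by blast
    then have "card (young_diagram mu) < card (young_diagram lam)"
      using finite_young_diagram psubset_card_mono by blast
    then have "congruent_above l (maya mu)"
      using less.hyps S(2) less.prems(2) rem by (meson converse_rtranclp_into_rtranclp)
    then show "congruent_above l (move l b (maya lam))" using S(5) by simp
  qed
qed

theorem theorem2p2p1p6:
  fixes l :: nat and lam :: "nat list"
  assumes "l \<ge> 2" and "is_partition lam"
  shows "l_partition l lam \<longleftrightarrow>
    (\<forall>a b c. (a, c) \<in> young_diagram lam \<and> (b, c) \<in> young_diagram lam \<longrightarrow>
       nu l (int (hook_length lam (a, c))) = nu l (int (hook_length lam (b, c))))"
proof -
  have "l_partition l lam \<longleftrightarrow> congruent_above l (maya lam)"
  proof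
    assume "l_partition l lam"
    then show "congruent_above l (maya lam)"
      using no_non_horizontal_congruent_above assms by (simp add: l_partition_def)
  next
    assume C: "congruent_above l (maya lam)"
    have "no_non_horizontal l mu" if "(remove_horizontal l)\<^sup>*\<^sup>* lam mu" for mu
      using congruent_above_no_non_horizontal congruent_above_remove_horizontal[OF that] C assms
      by simp
    then show "l_partition l lam"
      using congruent_above_regular C assms by (simp add: l_partition_def)
  qed
  then show ?thesis using hook_condition_iff_congruent_above[OF assms(2)] by simp
qed

end
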